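(* Let $G=(V,E)$ be a graph. The subgraph counting polynomial $H(G,v,x,y)$ and the edge elimination polynomial $\xi(G,x,y,z)$ are equivalent graph polynomials related by $$H(G,v,x,y)=v^{|V|}\cdot \xi\left(G,\,\frac{1+vx}{v},\,y,\,-\frac{y}{v}\right),$$ $$\xi(G,x,y,z)=(x-y)^{|V|}\cdot H\left(G,\,\frac{1}{x-y},\,y,\,\frac{z}{x-y}\right).$$
   Context: A graph $G=(V,E)$ consists of a vertex set $V$ and a multiset $E$ of edges, each edge being a one- or two-element subset of $V$ (so loops and parallel edges are allowed). A vertex $w$ and an edge $e$ are incident if $w\in e$. $k(G)$ denotes the number of connected components of $G$. A subgraph $H=(W,F)\subseteq G$ is a graph with $W\subseteq V$ and $F\subseteq E$. A graph polynomial is a function mapping isomorphic graphs to the same polynomial. Two graph polynomials are equivalent if each can be calculated from the other (here only by variable substitution and multiplication with a constant factor). For an edge $e$ of $G$: $G_{-e}$ (deletion) is $G$ with the edge $e$ removed; $G_{/e}$ (contraction) is obtained by removing $e$ and merging its incident vertices (parallel edges and loops may occur); $G_{\dagger e}$ (extraction) is obtained by deleting all vertices incident to $e$, together with the edges incident to these vertices. $G^1\mathbin{\dot\cup} G^2$ is the disjoint union of the graphs $G^1$ and $G^2$, and $K_1$ is the complete graph on one vertex. Subgraph counting polynomial: $H(G,v,x,y)=\sum_{H=(W,F)\subseteq G} v^{|W|}x^{k(H)}y^{|F|}$. Edge elimination polynomial: $\xi(G,x,y,z)$ is the graph polynomial defined by $\xi(G,x,y,z)=\xi(G_{-e},x,y,z)+y\cdot\xi(G_{/e},x,y,z)+z\cdot\xi(G_{\dagger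 e},x,y,z)$ for an edge $e$ of $G$, $\xi(G^1\mathbin{\dot\cup} G^2,x,y,z)=\xi(G^1,x,y,z)\cdot\xi(G^2,x,y,z)$, and $\xi(K_1,x,y,z)=x$.
   Formalization: The second displayed identity is false as printed (one vertex with a loop: x+xy+z versus x+yz/(x-y)); it is replaced by the inverse of the first: ξ(G,x,y,z) = (-z/y)^|V| · H(G, -y/z, x+z/y, y) for y, z nonzero. *)

theory Defs
  imports "HOL-Computational_Algebra.Computational_Algebra"
begin

text \<open>
  Edges are labels carrying a set of one or two end vertices. Parallel edges are distinct labels
  with equal end sets, so a subset of the edge labels tells parallel edges apart.
\<close>

record ('v, 'e) mgraph =
  verts :: "'v set"
  edges :: "'e set"
  ends :: "'e \<Rightarrow> 'v set"

definition multigraph :: "('v, 'e) mgraph \<Rightarrow> bool" where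
  "multigraph G \<longleftrightarrow> finite (verts G) \<and> finite (edges G) \<and>
     (\<forall>e\<in>edges G. ends G e \<subseteq> verts G \<and> card (ends G e) \<in> {1, 2})"

definition isomorphic :: "('v, 'e) mgraph \<Rightarrow> ('v, 'e) mgraph \<Rightarrow> bool" where
  "isomorphic G G' \<longleftrightarrow> (\<exists>f g. bij_betw f (verts G) (verts G') \<and> bij_betw g (edges G) (edges G') \<and>
     (\<forall>e\<in>edges G. ends G' (g e) = f ` ends G e))"

definition adjacency :: "('v, 'e) mgraph \<Rightarrow> ('v \<times> 'v) set" where
  "adjacency G = {(u, w). \<exists>e\<in>edges G. ends G e = {u, w}}"

definition components :: "('v, 'e) mgraph \<Rightarrow> 'v set set" where
  "components G = verts G // Restr ((adjacency G)\<^sup>*) (verts G)"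

definition num_components :: "('v, 'e) mgraph \<Rightarrow> nat" where
  "num_components G = card (components G)"

text \<open>
  The incidence function is kept unchanged, so a subgraph corresponds to exactly one pair of a
  vertex set and an edge set.
\<close>

definition subgraphs :: "('v, 'e) mgraph \<Rightarrow> ('v, 'e) mgraph set" where
  "subgraphs G = {H. multigraph H \<and> verts H \<subseteq> verts G \<and> edges H \<subseteq> edges G \<and> ends H = ends G}"

definition delete_edge :: "('v, 'e) mgraph \<Rightarrow> 'e \<Rightarrow> ('v, 'e) mgraph" where
  "delete_edge G e = G\<lparr>edges := edges G - {e}\<rparr>"

text \<open>
  Merging replaces the end vertices of the edge by one of them; the choice only affects the result
  up to isomorphism.
\<close>

definition merge_ends :: "('v, 'e) mgraph \<Rightarrow> 'e \<Rightarrow> 'v \<Rightarrow> 'v" where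
  "merge_ends G e u = (if u \<in> ends G e then (SOME w. w \<in> ends G e) else u)"

definition contract_edge :: "('v, 'e) mgraph \<Rightarrow> 'e \<Rightarrow> ('v, 'e) mgraph" where
  "contract_edge G e = \<lparr>verts = merge_ends G e ` verts G, edges = edges G - {e},
     ends = (\<lambda>d. merge_ends G e ` ends G d)\<rparr>"

definition extract_edge :: "('v, 'e) mgraph \<Rightarrow> 'e \<Rightarrow> ('v, 'e) mgraph" where
  "extract_edge G e = G\<lparr>verts := verts G - ends G e,
     edges := {d \<in> edges G. ends G d \<inter> ends G e = {}}\<rparr>"

definition disjoint_graphs :: "('v, 'e) mgraph \<Rightarrow> ('v, 'e) mgraph \<Rightarrow> bool" where
  "disjoint_graphs G G' \<longleftrightarrow> verts G \<inter> verts G' = {} \<and> edges G \<inter> edges G' = {}"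

definition graph_union :: "('v, 'e) mgraph \<Rightarrow> ('v, 'e) mgraph \<Rightarrow> ('v, 'e) mgraph" where
  "graph_union G G' = \<lparr>verts = verts G \<union> verts G', edges = edges G \<union> edges G',
     ends = (\<lambda>e. if e \<in> edges G then ends G e else ends G' e)\<rparr>"

text \<open>Integer polynomials in three variables, the first variable being the innermost one.\<close>

type_synonym poly3 = "int poly poly poly"

definition Var1 :: poly3 where "Var1 = [:[:[:0, 1:]:]:]"
definition Var2 :: poly3 where "Var2 = [:[:0, 1:]:]"
definition Var3 :: poly3 where "Var3 = [:0, 1:]"

definition eval3 :: "poly3 \<Rightarrow> 'a::comm_ring_1 \<Rightarrow> 'a \<Rightarrow> 'a \<Rightarrow> 'a" where
  "eval3 p a b c =
     poly (map_poly (\<lambda>q. poly (map_poly (\<lambda>r. poly (map_poly of_int r) a) q) b) p) c"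

definition graph_polynomial :: "(('v, 'e) mgraph \<Rightarrow> poly3) \<Rightarrow> bool" where
  "graph_polynomial P \<longleftrightarrow>
     (\<forall>G G'. multigraph G \<and> multigraph G' \<and> isomorphic G G' \<longrightarrow> P G = P G')"

text \<open>
  The substituted terms \<open>a\<close>, \<open>b\<close>, \<open>c\<close> and the factor \<open>d\<close> are rational functions that do not depend
  on the graph; the factor enters once for each vertex.
\<close>

definition calculable_from ::
  "(('v, 'e) mgraph \<Rightarrow> poly3) \<Rightarrow> (('v, 'e) mgraph \<Rightarrow> poly3) \<Rightarrow> bool" where
  "calculable_from P Q \<longleftrightarrow> (\<exists>a b c d :: poly3 fract. \<forall>G. multigraph G \<longrightarrow>
     to_fract (P G) = d ^ card (verts G) * eval3 (Q G) a b c)"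

definition equivalent_graph_polynomials ::
  "(('v, 'e) mgraph \<Rightarrow> poly3) \<Rightarrow> (('v, 'e) mgraph \<Rightarrow> poly3) \<Rightarrow> bool" where
  "equivalent_graph_polynomials P Q \<longleftrightarrow> graph_polynomial P \<and> graph_polynomial Q \<and>
     calculable_from P Q \<and> calculable_from Q P"

definition subgraph_counting_poly :: "('v, 'e) mgraph \<Rightarrow> poly3" where
  "subgraph_counting_poly G =
     (\<Sum>H\<in>subgraphs G. Var1 ^ card (verts H) * Var2 ^ num_components H * Var3 ^ card (edges H))"

definition is_edge_elimination :: "(('v, 'e) mgraph \<Rightarrow> poly3) \<Rightarrow> bool" where
  "is_edge_elimination \<xi> \<longleftrightarrow> graph_polynomial \<xi> \<and>
     (\<forall>G e. multigraph G \<and> e \<in> edges G \<longrightarrow>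
        \<xi> G = \<xi> (delete_edge G e) + Var2 * \<xi> (contract_edge G e) + Var3 * \<xi> (extract_edge G e)) \<and>
     (\<forall>G G'. multigraph G \<and> multigraph G' \<and> disjoint_graphs G G' \<longrightarrow>
        \<xi> (graph_union G G') = \<xi> G * \<xi> G') \<and>
     (\<forall>G u. verts G = {u} \<and> edges G = {} \<longrightarrow> \<xi> G = Var1)"

text \<open>
  The recurrences determine the values on all graphs satisfying \<open>multigraph\<close> uniquely; the choice
  only concerns records that do not.
\<close>

definition edge_elimination_poly :: "('v, 'e) mgraph \<Rightarrow> poly3" where
  "edge_elimination_poly = (SOME \<xi>. is_edge_elimination \<xi>)"

text \<open>
  The substitution inverse to \<open>(v, x, y) \<mapsto> ((1 + v x) / v, y, - y / v)\<close> is
  \<open>(x, y, z) \<mapsto> (- y / z, x + z / y, y)\<close>. The source prints the inverse relation as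
  \<open>\<xi>(G, x, y, z) = (x - y)^|V| H(G, 1 / (x - y), y, z / (x - y))\<close>, which is incorrect: for a single
  vertex with a loop the left side is \<open>x + x y + z\<close> and the right side \<open>x + y z / (x - y)\<close>.
\<close>

end

theory Submission
  imports Defs
begin

text \<open>
  Fix an edge \<open>e\<close>. The subgraphs that avoid \<open>e\<close> are those of the deletion \<open>G - e\<close>. A subgraph that
  uses \<open>e\<close> contracts to a subgraph of \<open>G / e\<close> containing the merged vertex; this loses one edge and
  \<open>|e| - 1\<close> vertices and keeps the number of components. The subgraphs of \<open>G / e\<close> that miss the merged
  vertex are the subgraphs of the extraction. Summing the weights gives
  \<open>H(G) = H(G - e) + y v^(|e| - 1) (H(G / e) - H(extraction))\<close> (lemma \<open>subgraph_sum_recurrence\<close>).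

  The factor \<open>v^(|e| - 1)\<close> disappears after normalising: \<open>v^(- |V|) H(G, v, x, y)\<close> satisfies the
  edge elimination recurrence with coefficients \<open>y\<close> and \<open>- y / v\<close>, and takes the value
  \<open>((1 + v x) / v)^|V|\<close> on edgeless graphs (\<open>scaled_subgraph_sum_eliminates_edges\<close>). The recurrence and
  the edgeless values determine a function on multigraphs, by induction on the number of edges
  (\<open>eliminates_edges_unique\<close>), so \<open>v^(- |V|) H\<close> is \<open>\<xi>\<close> at \<open>((1 + v x) / v, y, - y / v)\<close>. The
  substitution is invertible for nonzero \<open>y\<close> and \<open>z\<close>, which gives the second identity.

  It also has to be shown that \<open>\<xi>\<close> exists, that is, that the result of the recurrence does not depend on
  the order in which edges are eliminated. The same computation provides this: over the field of
  rational functions, the normalised subgraph sum at the inverse substitution satisfies the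
  recurrence, is multiplicative and is invariant under isomorphism, since \<open>H\<close> is. Its values are built by
  the recurrence from the three variables without division, hence they are polynomials
  (\<open>eliminates_edges_integral\<close>, \<open>edge_elimination_exists\<close>).
\<close>

section \<open>Reachability and components\<close>

lemma multigraph_ends:
  assumes "multigraph G" "d \<in> edges G"
  shows "ends G d \<subseteq> verts G" "ends G d \<noteq> {}" "finite (ends G d)"
  using assms by (auto simp: multigraph_def dest!: bspec intro: finite_subset)

lemma adjacency_in_verts:
  assumes "multigraph G" "(u, w) \<in> adjacency G"
  shows "u \<in> verts G" "w \<in> verts G"
  using assms by (auto simp: adjacency_def dest: multigraph_ends(1))

lemma reachable_sym: "(u, w) \<in> (adjacency G)\<^sup>* \<Longrightarrow> (w, u) \<in> (adjacency G)\<^sup>*"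
  by (rule symD[OF sym_rtrancl]) (auto simp: sym_def adjacency_def insert_commute)

lemma reachable_in_verts:
  assumes "multigraph G" "(u, w) \<in> (adjacency G)\<^sup>*" "u \<in> verts G"
  shows "w \<in> verts G"
  using assms(2,3) by (induction rule: rtrancl_induct) (auto dest: adjacency_in_verts[OF assms(1)])

lemma ends_reachable:
  assumes "multigraph G" "d \<in> edges G" "p \<in> ends G d" "q \<in> ends G d"
  shows "(p, q) \<in> (adjacency G)\<^sup>*"
proof (cases "p = q")
  case False
  have "card (ends G d) \<in> {1, 2}"
    using assms by (auto simp: multigraph_def)
  with False assms(3,4) have "ends G d = {p, q}"
    by (auto simp: card_1_singleton_iff card_2_iff)
  with assms(2) show ?thesis
    by (auto simp: adjacency_def intro!: r_into_rtrancl)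
qed simp

lemma components_eq_image:
  assumes "multigraph G"
  shows "components G = (\<lambda>u. (adjacency G)\<^sup>* `` {u}) ` verts G"
proof -
  have "Restr ((adjacency G)\<^sup>*) (verts G) `` {u} = (adjacency G)\<^sup>* `` {u}" if "u \<in> verts G" for u
    using that by (auto intro: reachable_in_verts[OF assms])
  then show ?thesis
    by (auto simp: components_def quotient_def)
qed

text \<open>
  Passing to the quotient by a vertex map \<open>\<phi>\<close> neither joins nor separates components if each fibre of
  \<open>\<phi>\<close> lies in one component, edges go to connected pairs, and every edge of the target lifts to a
  connected pair. Then \<open>\<phi>\<close> maps reachability classes bijectively to reachability classes. Isomorphisms
  and the merging map of a contraction are both of this kind.
\<close>

lemma num_components_eq_of_map:
  assumes G: "multigraph G" and G': "multigraph G'" and onto: "\<phi> ` verts G = verts G'"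
    and fibre: "\<And>u w. u \<in> verts G \<Longrightarrow> w \<in> verts G \<Longrightarrow> \<phi> u = \<phi> w \<Longrightarrow> (u, w) \<in> (adjacency G)\<^sup>*"
    and push: "\<And>u w. (u, w) \<in> adjacency G \<Longrightarrow> (\<phi> u, \<phi> w) \<in> (adjacency G')\<^sup>*"
    and lift: "\<And>a b. (a, b) \<in> adjacency G' \<Longrightarrow>
      \<exists>u\<in>verts G. \<exists>w\<in>verts G. \<phi> u = a \<and> \<phi> w = b \<and> (u, w) \<in> (adjacency G)\<^sup>*"
  shows "num_components G = num_components G'"
proof -
  let ?R = "(adjacency G)\<^sup>*" and ?R' = "(adjacency G')\<^sup>*"
  \<comment> \<open>Reachability is preserved and reflected: paths are pushed forward, and lifted edge by edge, the
    lifted pieces being connected inside the fibres.\<close>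
  have push_path: "(\<phi> u, \<phi> w) \<in> ?R'" if "(u, w) \<in> ?R" for u w
    using that by (induction rule: rtrancl_induct) (blast intro: push rtrancl_trans)+
  have lift_path: "\<forall>w\<in>verts G. \<phi> w = b \<longrightarrow> (u, w) \<in> ?R" if "(\<phi> u, b) \<in> ?R'" "u \<in> verts G" for u b
    using that
  proof (induction rule: rtrancl_induct)
    case base
    then show ?case by (auto intro: fibre)
  next
    case (step b c)
    from lift[OF step(2)] obtain p q where pq: "p \<in> verts G" "q \<in> verts G" "\<phi> p = b" "\<phi> q = c"
      "(p, q) \<in> ?R" by blast
    with step have "(u, q) \<in> ?R" by (blast intro: rtrancl_trans)
    with pq show ?case by (metis fibre rtrancl_trans)
  qed
  have image_class: "\<phi> ` (?R `` {u}) = ?R' `` {\<phi> u}" if u: "u \<in> verts G" for u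
  proof (intro equalityI subsetI)
    fix b assume "b \<in> ?R' `` {\<phi> u}"
    then have b: "(\<phi> u, b) \<in> ?R'" by simp
    then have "b \<in> verts G'" using reachable_in_verts[OF G' b] u onto by blast
    then obtain w where "w \<in> verts G" "\<phi> w = b" unfolding onto[symmetric] by (elim imageE) simp
    with lift_path[OF b u] show "b \<in> \<phi> ` (?R `` {u})" by blast
  qed (auto intro: push_path)
  have "inj_on (image \<phi>) (components G)"
  proof (rule inj_onI)
    fix C D assume "C \<in> components G" "D \<in> components G" and eq: "\<phi> ` C = \<phi> ` D"
    then obtain u w where u: "u \<in> verts G" "C = ?R `` {u}" and w: "w \<in> verts G" "D = ?R `` {w}"
      by (auto simp: components_eq_image[OF G])
    from eq have "(\<phi> u, \<phi> w) \<in> ?R'"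
      using image_class[OF u(1)] image_class[OF w(1)] u(2) w(2) by auto
    with lift_path u(1) w(1) have uw: "(u, w) \<in> ?R" by blast
    then have "(w, u) \<in> ?R" by (rule reachable_sym)
    with uw show "C = D" unfolding u(2) w(2) by (blast intro: rtrancl_trans)
  qed
  moreover have "image \<phi> ` components G = components G'"
    by (auto simp: components_eq_image[OF G] components_eq_image[OF G'] onto[symmetric] image_image
        image_class image_iff)
  ultimately show ?thesis
    unfolding num_components_def by (metis card_image)
qed

lemma num_components_isomorphic:
  assumes G: "multigraph G" and G': "multigraph G'" and iso: "isomorphic G G'"
  shows "num_components G = num_components G'"
proof -
  obtain f g where f: "bij_betw f (verts G) (verts G')" and g: "bij_betw g (edges G) (edges G')"
    and fg: "\<And>e. e \<in> edges G \<Longrightarrow> ends G' (g e) = f ` ends G e"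
    using iso by (auto simp: isomorphic_def)
  show ?thesis
  proof (rule num_components_eq_of_map[OF G G', of f])
    show "f ` verts G = verts G'" using f by (simp add: bij_betw_def)
    show "(u, w) \<in> (adjacency G)\<^sup>*" if "u \<in> verts G" "w \<in> verts G" "f u = f w" for u w
      using that f by (auto simp: bij_betw_def inj_on_def)
  next
    fix u w assume "(u, w) \<in> adjacency G"
    then obtain e where e: "e \<in> edges G" "ends G e = {u, w}" by (auto simp: adjacency_def)
    then have "g e \<in> edges G'" "ends G' (g e) = {f u, f w}"
      using g fg by (auto simp: bij_betw_def)
    then show "(f u, f w) \<in> (adjacency G')\<^sup>*" by (auto simp: adjacency_def)
  next
    fix a b assume "(a, b) \<in> adjacency G'"
    then obtain e' where e': "e' \<in> edges G'" "ends G' e' = {a, b}" by (auto simp: adjacency_def)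
    then obtain e where e: "e \<in> edges G" "f ` ends G e = {a, b}"
      using g fg by (metis bij_betw_imp_surj_on imageE)
    then have "a \<in> f ` ends G e" "b \<in> f ` ends G e" by simp_all
    then obtain u w where "u \<in> ends G e" "w \<in> ends G e" "f u = a" "f w = b"
      by (elim imageE) simp
    then show "\<exists>u\<in>verts G. \<exists>w\<in>verts G. f u = a \<and> f w = b \<and> (u, w) \<in> (adjacency G)\<^sup>*"
      using ends_reachable[OF G e(1)] multigraph_ends(1)[OF G e(1)] by blast
  qed
qed

section \<open>Components under contraction and disjoint union\<close>

lemma multigraph_delete: "multigraph G \<Longrightarrow> multigraph (delete_edge G e)"
  by (auto simp: multigraph_def delete_edge_def)

lemma multigraph_extract: "multigraph G \<Longrightarrow> multigraph (extract_edge G e)"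
  by (auto simp: multigraph_def extract_edge_def)

lemma multigraph_contract:
  assumes "multigraph G"
  shows "multigraph (contract_edge G e)"
proof -
  have "card (merge_ends G e ` ends G d) \<in> {1, 2}" if "d \<in> edges G" for d
  proof -
    have "card (ends G d) \<in> {1, 2}" using assms that by (auto simp: multigraph_def)
    moreover have "card (merge_ends G e ` ends G d) \<le> card (ends G d)"
      using multigraph_ends[OF assms that] by (simp add: card_image_le)
    moreover have "card (merge_ends G e ` ends G d) > 0"
      using multigraph_ends[OF assms that] by (simp add: card_gt_0_iff)
    ultimately show ?thesis by auto
  qed
  with assms show ?thesis
    by (auto simp: multigraph_def contract_edge_def)
qed

lemma merge_ends_in: "u \<in> ends G e \<Longrightarrow> merge_ends G e u \<in> ends G e"
  unfolding merge_ends_def by (metis someI)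

lemma merge_ends_eq_iff:
  "merge_ends G e u = merge_ends G e w \<longleftrightarrow> u = w \<or> u \<in> ends G e \<and> w \<in> ends G e"
  using merge_ends_in[of u G e] merge_ends_in[of w G e] by (auto simp: merge_ends_def)

lemma num_components_contract:
  assumes G: "multigraph G" and e: "e \<in> edges G"
  shows "num_components (contract_edge G e) = num_components G"
proof (rule sym, rule num_components_eq_of_map[OF G multigraph_contract[OF G], of "merge_ends G e"])
  let ?m = "merge_ends G e"
  show "?m ` verts G = verts (contract_edge G e)" by (simp add: contract_edge_def)
  show fibre: "(u, w) \<in> (adjacency G)\<^sup>*" if "?m u = ?m w" for u w
    using that ends_reachable[OF G e] by (auto simp: merge_ends_eq_iff)
  show "(?m u, ?m w) \<in> (adjacency (contract_edge G e))\<^sup>*" if uw: "(u, w) \<in> adjacency G" for u w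
  proof -
    obtain d where d: "d \<in> edges G" "ends G d = {u, w}" using uw by (auto simp: adjacency_def)
    show ?thesis
    proof (cases "d = e")
      case True
      then have "?m u = ?m w" using d by (simp add: merge_ends_eq_iff)
      then show ?thesis by simp
    next
      case False
      then have "(?m u, ?m w) \<in> adjacency (contract_edge G e)"
        using d by (auto simp: adjacency_def contract_edge_def intro!: bexI[of _ d])
      then show ?thesis by simp
    qed
  qed
  fix a b assume "(a, b) \<in> adjacency (contract_edge G e)"
  then obtain d where d: "d \<in> edges G" "?m ` ends G d = {a, b}"
    by (auto simp: adjacency_def contract_edge_def)
  then have "a \<in> ?m ` ends G d" "b \<in> ?m ` ends G d" by simp_all
  then obtain u w where "u \<in> ends G d" "w \<in> ends G d" "?m u = a" "?m w = b"
    by (elim imageE) simp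
  then show "\<exists>u\<in>verts G. \<exists>w\<in>verts G. ?m u = a \<and> ?m w = b \<and> (u, w) \<in> (adjacency G)\<^sup>*"
    using ends_reachable[OF G d(1)] multigraph_ends(1)[OF G d(1)] by blast
qed

lemma multigraph_union:
  "multigraph G \<Longrightarrow> multigraph G' \<Longrightarrow> multigraph (graph_union G G')"
  unfolding multigraph_def graph_union_def by (auto split: if_splits)

lemma adjacency_union:
  assumes "disjoint_graphs G G'"
  shows "adjacency (graph_union G G') = adjacency G \<union> adjacency G'"
proof -
  have "ends (graph_union G G') d = ends G d" if "d \<in> edges G" for d
    using that by (simp add: graph_union_def)
  moreover have "ends (graph_union G G') d = ends G' d" if "d \<in> edges G'" for d
    using that assms by (auto simp: graph_union_def disjoint_graphs_def)
  moreover have "edges (graph_union G G') = edges G \<union> edges G'"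
    by (simp add: graph_union_def)
  ultimately have "(\<exists>d\<in>edges (graph_union G G'). ends (graph_union G G') d = S) \<longleftrightarrow>
      (\<exists>d\<in>edges G. ends G d = S) \<or> (\<exists>d\<in>edges G'. ends G' d = S)" for S
    by (simp add: bex_Un cong: bex_cong)
  then show ?thesis
    unfolding adjacency_def by auto
qed

lemma reachable_Un_iff:
  assumes "A' \<subseteq> V' \<times> V'" "A \<subseteq> V \<times> V" "V \<inter> V' = {}" "u \<in> V"
  shows "(u, w) \<in> (A \<union> A')\<^sup>* \<longleftrightarrow> (u, w) \<in> A\<^sup>*"
proof
  assume "(u, w) \<in> (A \<union> A')\<^sup>*"
  then have "(u, w) \<in> A\<^sup>* \<and> w \<in> V"
    using assms by (induction rule: rtrancl_induct) (auto intro: rtrancl_into_rtrancl)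
  then show "(u, w) \<in> A\<^sup>*" ..
qed (auto intro: in_rtrancl_UnI)

lemma num_components_union:
  assumes G: "multigraph G" and G': "multigraph G'" and dis: "disjoint_graphs G G'"
  shows "num_components (graph_union G G') = num_components G + num_components G'"
proof -
  let ?U = "graph_union G G'"
  have sub: "adjacency G \<subseteq> verts G \<times> verts G" "adjacency G' \<subseteq> verts G' \<times> verts G'"
    using adjacency_in_verts G G' by (fast+)
  have dv: "verts G \<inter> verts G' = {}" using dis by (simp add: disjoint_graphs_def)
  have "(adjacency ?U)\<^sup>* `` {u} = (adjacency G)\<^sup>* `` {u}" if "u \<in> verts G" for u
    using reachable_Un_iff[OF sub(2,1) dv that] by (auto simp: adjacency_union[OF dis])
  moreover have "(adjacency ?U)\<^sup>* `` {u} = (adjacency G')\<^sup>* `` {u}" if "u \<in> verts G'" for u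
    using reachable_Un_iff[OF sub(1,2) _ that] dv by (auto simp: adjacency_union[OF dis] Un_commute)
  ultimately have "components ?U = components G \<union> components G'"
    unfolding components_eq_image[OF G] components_eq_image[OF G']
      components_eq_image[OF multigraph_union[OF G G']]
    by (simp add: graph_union_def image_Un)
  moreover have "components G \<inter> components G' = {}"
  proof -
    have "(adjacency G)\<^sup>* `` {u} \<noteq> (adjacency G')\<^sup>* `` {w}" if "u \<in> verts G" "w \<in> verts G'" for u w
      using reachable_in_verts[OF G' _ that(2), of u] that(1) dv by blast
    then show ?thesis
      unfolding components_eq_image[OF G] components_eq_image[OF G'] by blast
  qed
  moreover have "finite (components G)" "finite (components G')"
    using G G' by (simp_all add: components_eq_image multigraph_def)
  ultimately show ?thesis
    by (simp add: num_components_def card_Un_disjoint)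
qed

lemma num_components_edgeless:
  assumes "multigraph G" "edges G = {}"
  shows "num_components G = card (verts G)"
proof -
  have "adjacency G = {}" using assms by (simp add: adjacency_def)
  then have "components G = (\<lambda>u. {u}) ` verts G"
    by (auto simp: components_eq_image[OF assms(1)])
  then show ?thesis by (simp add: num_components_def card_image)
qed

section \<open>The subgraph sum\<close>

text \<open>
  The subgraph counting polynomial is needed at rational functions and at elements of an arbitrary field.
  Therefore the sum is formed directly in a commutative ring, with the variables replaced by ring elements.
\<close>

definition subgraph_weight :: "'a \<Rightarrow> 'a \<Rightarrow> 'a \<Rightarrow> ('v, 'e) mgraph \<Rightarrow> 'a::comm_ring_1" where
  "subgraph_weight v x y H = v ^ card (verts H) * x ^ num_components H * y ^ card (edges H)"

definition subgraph_sum :: "'a \<Rightarrow> 'a \<Rightarrow> 'a \<Rightarrow> ('v, 'e) mgraph \<Rightarrow> 'a::comm_ring_1" where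
  "subgraph_sum v x y G = (\<Sum>H\<in>subgraphs G. subgraph_weight v x y H)"

lemma subgraph_weight_isomorphic:
  assumes "multigraph G" "multigraph G'" "isomorphic G G'"
  shows "subgraph_weight v x y G = subgraph_weight v x y G'"
  using num_components_isomorphic[OF assms] assms(3)
  by (auto simp: subgraph_weight_def isomorphic_def dest!: bij_betw_same_card)

lemma isomorphic_same_ends:
  assumes "verts G = verts G'" "edges G = edges G'" "\<And>d. d \<in> edges G \<Longrightarrow> ends G d = ends G' d"
  shows "isomorphic G G'"
  unfolding isomorphic_def using assms by (intro exI[of _ id]) simp

text \<open>
  Values of the incidence map outside the edge set do not affect the weight. Subgraphs
  of a contraction or of a union carry other such values than the corresponding subgraphs of the
  original graphs.
\<close>

lemma subgraph_weight_same_ends: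
  assumes "multigraph G" "multigraph G'" "verts G = verts G'" "edges G = edges G'"
    "\<And>d. d \<in> edges G \<Longrightarrow> ends G d = ends G' d"
  shows "subgraph_weight v x y G = subgraph_weight v x y G'"
  using assms by (intro subgraph_weight_isomorphic isomorphic_same_ends)

lemma in_subgraphs_iff:
  assumes "multigraph G"
  shows "H \<in> subgraphs G \<longleftrightarrow> verts H \<subseteq> verts G \<and> edges H \<subseteq> edges G \<and> ends H = ends G \<and>
    (\<forall>d\<in>edges H. ends G d \<subseteq> verts H)"
proof -
  have "finite (verts G)" "finite (edges G)" "\<forall>d\<in>edges G. card (ends G d) \<in> {1, 2}"
    using assms by (auto simp: multigraph_def)
  then show ?thesis
    unfolding subgraphs_def multigraph_def
    by (auto intro: finite_subset; blast)
qed

lemma subgraph_multigraph: "H \<in> subgraphs G \<Longrightarrow> multigraph H"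
  by (simp add: subgraphs_def)

lemma finite_subgraphs:
  assumes "multigraph G"
  shows "finite (subgraphs G)"
proof (rule finite_subset)
  show "subgraphs G \<subseteq> (\<lambda>(W, F). \<lparr>verts = W, edges = F, ends = ends G\<rparr>) ` (Pow (verts G) \<times> Pow (edges G))"
  proof
    fix H assume "H \<in> subgraphs G"
    then have "verts H \<in> Pow (verts G)" "edges H \<in> Pow (edges G)"
      "H = \<lparr>verts = verts H, edges = edges H, ends = ends G\<rparr>"
      by (auto simp: subgraphs_def)
    then show "H \<in> (\<lambda>(W, F). \<lparr>verts = W, edges = F, ends = ends G\<rparr>) ` (Pow (verts G) \<times> Pow (edges G))"
      by (metis (no_types, lifting) SigmaI case_prod_conv image_eqI)
  qed
  show "finite ((\<lambda>(W, F). \<lparr>verts = W, edges = F, ends = ends G\<rparr>) ` (Pow (verts G) \<times> Pow (edges G)))"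
    using assms by (simp add: multigraph_def)
qed

lemma subgraph_sum_isomorphic:
  fixes G G' :: "('v, 'e) mgraph"
  assumes G: "multigraph G" and G': "multigraph G'" and iso: "isomorphic G G'"
  shows "subgraph_sum v x y G = subgraph_sum v x y G'"
proof -
  obtain f g where f: "bij_betw f (verts G) (verts G')" and g: "bij_betw g (edges G) (edges G')"
    and fg: "\<And>e. e \<in> edges G \<Longrightarrow> ends G' (g e) = f ` ends G e"
    using iso by (auto simp: isomorphic_def)
  let ?f' = "inv_into (verts G) f" and ?g' = "inv_into (edges G) g"
  define push where "push H = \<lparr>verts = f ` verts H, edges = g ` edges H, ends = ends G'\<rparr>"
    for H :: "('v, 'e) mgraph"
  define pull where "pull H = \<lparr>verts = ?f' ` verts H, edges = ?g' ` edges H, ends = ends G\<rparr>"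
    for H :: "('v, 'e) mgraph"
  have injs: "inj_on f (verts G)" "inj_on g (edges G)"
    and imgs: "f ` verts G = verts G'" "g ` edges G = edges G'"
    using f g by (auto simp: bij_betw_def)
  have push_in: "push H \<in> subgraphs G'" if "H \<in> subgraphs G" for H
    using that imgs fg
    by (fastforce simp: in_subgraphs_iff[OF G] in_subgraphs_iff[OF G'] push_def)
  have fg': "ends G (?g' e) = ?f' ` ends G' e" if e: "e \<in> edges G'" for e
  proof -
    have e': "?g' e \<in> edges G" "g (?g' e) = e"
      using e imgs(2) by (auto intro: inv_into_into f_inv_into_f)
    then have "ends G' e = f ` ends G (?g' e)" using fg by metis
    then show ?thesis
      using multigraph_ends(1)[OF G e'(1)] injs(1) by (simp add: inv_into_image_cancel)
  qed
  have pull_in: "pull H \<in> subgraphs G" if "H \<in> subgraphs G'" for H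
  proof -
    have sub: "verts H \<subseteq> f ` verts G" "edges H \<subseteq> g ` edges G"
      and closed: "\<And>d. d \<in> edges H \<Longrightarrow> ends G' d \<subseteq> verts H"
      using that imgs by (auto simp: in_subgraphs_iff[OF G'])
    have "?f' ` verts H \<subseteq> verts G" "?g' ` edges H \<subseteq> edges G"
      using sub by (auto intro: inv_into_into)
    moreover have "ends G (?g' d) \<subseteq> ?f' ` verts H" if "d \<in> edges H" for d
    proof -
      have "d \<in> edges G'" using that sub(2) imgs(2) by blast
      then show ?thesis using closed[OF that] by (simp add: fg' image_mono)
    qed
    ultimately show ?thesis
      by (auto simp: in_subgraphs_iff[OF G] pull_def)
  qed
  show ?thesis
    unfolding subgraph_sum_def
  proof (rule sum.reindex_bij_witness[where i = pull and j = push])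
    fix H assume H: "H \<in> subgraphs G"
    then show "pull (push H) = H" "push H \<in> subgraphs G'"
      using injs push_in by (auto simp: in_subgraphs_iff[OF G] push_def pull_def inv_into_image_cancel)
    have sub: "verts H \<subseteq> verts G" "edges H \<subseteq> edges G" "ends H = ends G"
      using H by (auto simp: subgraphs_def)
    have "isomorphic H (push H)"
      unfolding isomorphic_def push_def
      using sub injs fg by (intro exI[of _ f] exI[of _ g]) (auto simp: bij_betw_def intro: inj_on_subset)
    then show "subgraph_weight v x y (push H) = subgraph_weight v x y H"
      using subgraph_weight_isomorphic subgraph_multigraph H push_in by metis
  next
    fix H assume H: "H \<in> subgraphs G'"
    then show "push (pull H) = H" "pull H \<in> subgraphs G"
      using imgs pull_in
      by (auto simp: in_subgraphs_iff[OF G'] push_def pull_def image_inv_into_cancel)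
  qed
qed

text \<open>
  A subgraph is a set \<open>W\<close> of isolated vertices and contributes \<open>(v x)^|W|\<close>, so the sum is a binomial
  expansion.
\<close>

lemma subgraph_sum_edgeless:
  fixes G :: "('v, 'e) mgraph"
  assumes G: "multigraph G" and no_edges: "edges G = {}"
  shows "subgraph_sum v x y G = (1 + v * x) ^ card (verts G)"
proof -
  have fin: "finite (verts G)" using G by (simp add: multigraph_def)
  have "subgraph_sum v x y G = (\<Sum>W\<in>Pow (verts G). (v * x) ^ card W)"
    unfolding subgraph_sum_def
  proof (rule sum.reindex_bij_witness
      [where i = "\<lambda>W. \<lparr>verts = W, edges = {}, ends = ends G\<rparr>" and j = verts])
    fix H assume H: "H \<in> subgraphs G"
    then have "edges H = {}" using no_edges by (auto simp: subgraphs_def)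
    then show "(v * x) ^ card (verts H) = subgraph_weight v x y H"
      using num_components_edgeless[OF subgraph_multigraph[OF H]]
      by (simp add: subgraph_weight_def power_mult_distrib)
  qed (use no_edges in \<open>auto simp: in_subgraphs_iff[OF G]\<close>)
  also have "\<dots> = (1 + v * x) ^ card (verts G)"
    using prod_add[OF fin, of "\<lambda>_. v * x" "\<lambda>_. 1"] by (simp add: add.commute)
  finally show ?thesis .
qed

text \<open>
  A subgraph of the union is a pair of subgraphs of the two parts, and all three exponents of the weight
  are additive over such pairs.
\<close>

lemma subgraph_sum_union:
  fixes G G' :: "('v, 'e) mgraph"
  assumes G: "multigraph G" and G': "multigraph G'" and dis: "disjoint_graphs G G'"
  shows "subgraph_sum v x y (graph_union G G') = subgraph_sum v x y G * subgraph_sum v x y G'"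
proof -
  let ?U = "graph_union G G'"
  have U: "multigraph ?U" by (rule multigraph_union[OF G G'])
  have dv: "verts G \<inter> verts G' = {}" and de: "edges G \<inter> edges G' = {}"
    using dis by (simp_all add: disjoint_graphs_def)
  \<comment> \<open>\<open>graph_union H H'\<close> decides by the edges of \<open>H\<close> which incidence map to use, the union of the whole
    graphs by the edges of \<open>G\<close>; \<open>join\<close> takes the latter map in order to be a subgraph.\<close>
  define join where "join = (\<lambda>(H, H'). graph_union H H' \<lparr>ends := ends ?U\<rparr>)"
  define part where "part K H = \<lparr>verts = verts H \<inter> verts K, edges = edges H \<inter> edges K, ends = ends K\<rparr>"
    for H K :: "('v, 'e) mgraph"
  have join_sel: "verts (join (H, H')) = verts H \<union> verts H'"
    "edges (join (H, H')) = edges H \<union> edges H'" "ends (join (H, H')) = ends ?U" for H H'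
    by (simp_all add: join_def graph_union_def)
  have ends_U: "d \<in> edges G \<Longrightarrow> ends ?U d = ends G d" "d \<in> edges G' \<Longrightarrow> ends ?U d = ends G' d" for d
    using de by (auto simp: graph_union_def)
  have UU: "verts ?U = verts G \<union> verts G'" "edges ?U = edges G \<union> edges G'"
    by (simp_all add: graph_union_def)
  have join_in: "join (H, H') \<in> subgraphs ?U" if "H \<in> subgraphs G" "H' \<in> subgraphs G'" for H H'
    using that ends_U unfolding in_subgraphs_iff[OF U] in_subgraphs_iff[OF G] in_subgraphs_iff[OF G']
      join_sel UU by (auto; blast)
  have part_in: "part G H \<in> subgraphs G" "part G' H \<in> subgraphs G'" if "H \<in> subgraphs ?U" for H
    using that ends_U multigraph_ends(1)[OF G] multigraph_ends(1)[OF G']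
    unfolding in_subgraphs_iff[OF U] in_subgraphs_iff[OF G] in_subgraphs_iff[OF G']
      part_def by (auto; blast)+
  have "(\<Sum>p\<in>subgraphs G \<times> subgraphs G'. subgraph_weight v x y (fst p) * subgraph_weight v x y (snd p))
      = subgraph_sum v x y ?U"
    unfolding subgraph_sum_def
  proof (rule sum.reindex_bij_witness[where i = "\<lambda>H. (part G H, part G' H)" and j = join])
    fix p assume "p \<in> subgraphs G \<times> subgraphs G'"
    then obtain H H' where p: "p = (H, H')" and H: "H \<in> subgraphs G" and H': "H' \<in> subgraphs G'"
      by auto
    have sub: "verts H \<subseteq> verts G" "edges H \<subseteq> edges G" "ends H = ends G"
      "verts H' \<subseteq> verts G'" "edges H' \<subseteq> edges G'" "ends H' = ends G'"
      using H H' by (auto simp: subgraphs_def)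
    show "(part G (join p), part G' (join p)) = p"
      unfolding p part_def join_sel prod.inject
      using sub dv de by (intro conjI mgraph.equality) auto
    show "join p \<in> subgraphs ?U" using join_in[OF H H'] p by simp
    have mH: "multigraph H" "multigraph H'" "disjoint_graphs H H'"
      using H H' sub dv de by (auto simp: disjoint_graphs_def dest: subgraph_multigraph)
    have "subgraph_weight v x y (join p) = subgraph_weight v x y (graph_union H H')"
    proof (rule subgraph_weight_same_ends)
      show "multigraph (join p)" using join_in[OF H H'] p by (auto dest: subgraph_multigraph)
      fix d assume "d \<in> edges (join p)"
      then consider "d \<in> edges H" | "d \<in> edges H'" "d \<notin> edges H"
        by (auto simp: p join_sel)
      then show "ends (join p) d = ends (graph_union H H') d"
      proof cases
        case 1
        then have "ends ?U d = ends G d" using sub(2) ends_U(1) by blast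
        then show ?thesis using 1 by (simp add: p join_sel sub(3) graph_union_def)
      next
        case 2
        then have "ends ?U d = ends G' d" using sub(5) ends_U(2) by blast
        then show ?thesis unfolding p join_sel using 2 by (simp add: sub(6) graph_union_def)
      qed
    qed (use multigraph_union[OF mH(1,2)] in \<open>auto simp: p join_sel graph_union_def\<close>)
    also have "\<dots> = subgraph_weight v x y H * subgraph_weight v x y H'"
    proof -
      have "verts H \<inter> verts H' = {}" "edges H \<inter> edges H' = {}" "finite (verts H)" "finite (edges H)"
        "finite (verts H')" "finite (edges H')"
        using mH by (auto simp: disjoint_graphs_def multigraph_def)
      then show ?thesis
        using num_components_union[OF mH]
        by (simp add: subgraph_weight_def graph_union_def card_Un_disjoint power_add)
    qed
    finally show "subgraph_weight v x y (join p) = subgraph_weight v x y (fst p) * subgraph_weight v x y (snd p)"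
      by (simp add: p)
  next
    fix H assume H: "H \<in> subgraphs ?U"
    show "(part G H, part G' H) \<in> subgraphs G \<times> subgraphs G'" using part_in[OF H] by simp
    show "join (part G H, part G' H) = H"
      by (rule mgraph.equality)
        (use H in \<open>auto simp: in_subgraphs_iff[OF U] join_sel UU part_def\<close>)
  qed
  then show ?thesis
    by (simp add: subgraph_sum_def sum_product sum.cartesian_product split_beta)
qed

section \<open>The recurrence for the subgraph sum\<close>

lemma subgraph_sum_delete:
  assumes "multigraph G"
  shows "(\<Sum>H\<in>{H \<in> subgraphs G. e \<notin> edges H}. subgraph_weight v x y H) =
    subgraph_sum v x y (delete_edge G e)"
proof -
  have "subgraphs (delete_edge G e) = {H \<in> subgraphs G. e \<notin> edges H}"
    by (auto simp: subgraphs_def delete_edge_def)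
  then show ?thesis by (simp add: subgraph_sum_def)
qed

lemma merge_ends_eq:
  assumes "w = (SOME w. w \<in> ends G e)"
  shows "merge_ends G e u = (if u \<in> ends G e then w else u)"
  by (simp add: merge_ends_def assms)

lemma card_contract_verts:
  assumes G: "multigraph G" and e: "e \<in> edges G"
  shows "card (verts G) + 1 = card (verts (contract_edge G e)) + card (ends G e)"
proof -
  define w where "w = (SOME w. w \<in> ends G e)"
  have w: "w \<in> ends G e"
    unfolding w_def using multigraph_ends(2)[OF G e] by (simp add: some_in_eq)
  have fin: "finite (verts G)" using G by (simp add: multigraph_def)
  have ends: "ends G e \<subseteq> verts G" "finite (ends G e)" using multigraph_ends[OF G e] by auto
  have "verts (contract_edge G e) = insert w (verts G - ends G e)"
    using w ends by (auto simp: contract_edge_def merge_ends_eq[OF w_def])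
  then have "card (verts (contract_edge G e)) = Suc (card (verts G - ends G e))"
    using w fin by simp
  moreover have "card (verts G - ends G e) = card (verts G) - card (ends G e)"
    "card (ends G e) \<le> card (verts G)"
    using ends fin by (simp_all add: card_Diff_subset card_mono)
  ultimately show ?thesis by simp
qed

lemma card_extract_verts:
  assumes G: "multigraph G" and e: "e \<in> edges G"
  shows "card (verts G) = card (verts (extract_edge G e)) + card (ends G e)"
proof -
  have "finite (verts G)" using G by (simp add: multigraph_def)
  then show ?thesis
    using multigraph_ends[OF G e] by (simp add: extract_edge_def card_Diff_subset card_mono)
qed

text \<open>
  The weight of a subgraph is compared with the weight of its own contraction: the edge \<open>e\<close> and all but
  one of its ends are lost. The exponent of \<open>v\<close> is \<open>0\<close> for a loop and \<open>1\<close> otherwise.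
\<close>

lemma subgraph_weight_contract:
  assumes G: "multigraph G" and e: "e \<in> edges G"
  shows "subgraph_weight v x y G =
    y * v ^ (card (ends G e) - 1) * subgraph_weight v x y (contract_edge G e)"
proof -
  have "card (ends G e) > 0" "finite (edges G)"
    using G e by (auto simp: multigraph_def)
  then have "card (verts G) = (card (ends G e) - 1) + card (verts (contract_edge G e))"
    using card_contract_verts[OF G e] by simp
  moreover have "card (edges G) = Suc (card (edges (contract_edge G e)))"
    using card.remove[OF \<open>finite (edges G)\<close> e] by (simp add: contract_edge_def)
  ultimately show ?thesis
    unfolding subgraph_weight_def num_components_contract[OF G e]
    by (simp add: power_add algebra_simps)
qed

text \<open>
  Here \<open>w\<close> is the end vertex into which \<open>merge_ends\<close> merges the ends of \<open>e\<close>. Contracting \<open>e\<close> inside a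
  subgraph that uses \<open>e\<close> is inverted by putting back \<open>e\<close> and its ends.
\<close>

lemma subgraph_sum_contract:
  fixes G :: "('v, 'e) mgraph"
  assumes G: "multigraph G" and e: "e \<in> edges G" and w: "w = (SOME w. w \<in> ends G e)"
  shows "(\<Sum>H\<in>{H \<in> subgraphs G. e \<in> edges H}. subgraph_weight v x y H) =
    y * v ^ (card (ends G e) - 1) *
      (\<Sum>K\<in>{K \<in> subgraphs (contract_edge G e). w \<in> verts K}. subgraph_weight v x y K)"
proof -
  let ?C = "contract_edge G e"
  have C: "multigraph ?C" by (rule multigraph_contract[OF G])
  have w_in: "w \<in> ends G e"
    unfolding w using multigraph_ends(2)[OF G e] by (simp add: some_in_eq)
  have ends_e: "ends G e \<subseteq> verts G" by (rule multigraph_ends(1)[OF G e])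
  note m = merge_ends_eq[OF w]
  have merge_sub: "merge_ends H e = merge_ends G e" if "ends H = ends G" for H :: "('v, 'e) mgraph"
    by (simp add: merge_ends_def that fun_eq_iff)
  define expand where
    "expand K = \<lparr>verts = verts K \<union> ends G e, edges = insert e (edges K), ends = ends G\<rparr>"
    for K :: "('v, 'e) mgraph"
  have "(\<Sum>H\<in>{H \<in> subgraphs G. e \<in> edges H}. subgraph_weight v x y H) =
    (\<Sum>K\<in>{K \<in> subgraphs ?C. w \<in> verts K}. y * v ^ (card (ends G e) - 1) * subgraph_weight v x y K)"
  proof (rule sum.reindex_bij_witness[where i = expand and j = "\<lambda>H. contract_edge H e"])
    fix H assume "H \<in> {H \<in> subgraphs G. e \<in> edges H}"
    then have H: "H \<in> subgraphs G" and eH: "e \<in> edges H" by auto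
    have sub: "verts H \<subseteq> verts G" "edges H \<subseteq> edges G" "ends H = ends G"
      "\<And>d. d \<in> edges H \<Longrightarrow> ends G d \<subseteq> verts H"
      using H by (auto simp: in_subgraphs_iff[OF G])
    have mH: "contract_edge H e = \<lparr>verts = merge_ends G e ` verts H, edges = edges H - {e},
        ends = \<lambda>d. merge_ends G e ` ends G d\<rparr>"
      by (simp add: contract_edge_def merge_sub[OF sub(3)] sub(3))
    show "expand (contract_edge H e) = H"
      by (rule mgraph.equality)
        (use sub(4)[OF eH] w_in eH in \<open>auto simp: expand_def mH m sub(3)\<close>)
    have "merge_ends G e ` verts H \<subseteq> merge_ends G e ` verts G"
      "\<forall>d\<in>edges H - {e}. merge_ends G e ` ends G d \<subseteq> merge_ends G e ` verts H"
      using sub(1,4) by (blast intro: image_mono)+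
    moreover have "w \<in> merge_ends G e ` verts H"
      using w_in sub(4)[OF eH] m by (metis image_eqI subsetD)
    ultimately show "contract_edge H e \<in> {K \<in> subgraphs ?C. w \<in> verts K}"
      using sub(2) unfolding mem_Collect_eq in_subgraphs_iff[OF C] mH
      by (simp add: contract_edge_def) blast
    show "y * v ^ (card (ends G e) - 1) * subgraph_weight v x y (contract_edge H e) = subgraph_weight v x y H"
      using subgraph_weight_contract[OF subgraph_multigraph[OF H] eH, of v x y] sub(3) by simp
  next
    fix K assume "K \<in> {K \<in> subgraphs ?C. w \<in> verts K}"
    then have K: "K \<in> subgraphs ?C" and wK: "w \<in> verts K" by auto
    have sub: "verts K \<subseteq> merge_ends G e ` verts G" "edges K \<subseteq> edges G - {e}"
      "ends K = (\<lambda>d. merge_ends G e ` ends G d)"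
      "\<And>d. d \<in> edges K \<Longrightarrow> merge_ends G e ` ends G d \<subseteq> verts K"
      using K unfolding in_subgraphs_iff[OF C] by (auto simp: contract_edge_def)
    \<comment> \<open>The only vertex of the contraction among the ends of \<open>e\<close> is \<open>w\<close>, which merging fixes.\<close>
    have fixed: "merge_ends G e u = u" if "u \<in> verts K" for u
      using that sub(1) w_in by (auto simp: m)
    have verts_K: "merge_ends G e ` (verts K \<union> ends G e) = verts K"
      using fixed wK w_in by (auto simp: image_Un) (auto simp: m)
    have "contract_edge (expand K) e =
        \<lparr>verts = merge_ends G e ` (verts K \<union> ends G e), edges = insert e (edges K) - {e},
          ends = \<lambda>d. merge_ends G e ` ends G d\<rparr>"
      using merge_sub[of "expand K"] by (simp add: contract_edge_def expand_def)
    also have "insert e (edges K) - {e} = edges K" using sub(2) by blast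
    finally show "contract_edge (expand K) e = K"
      unfolding verts_K sub(3)[symmetric] by simp
    have "ends G d \<subseteq> verts K \<union> ends G e" if "d \<in> edges K" for d
      using sub(4)[OF that] by (auto simp: m split: if_splits)
    moreover have "verts K \<subseteq> verts G"
      using sub(1) w_in ends_e by (auto simp: m)
    ultimately show "expand K \<in> {H \<in> subgraphs G. e \<in> edges H}"
      using sub(2) e ends_e by (auto simp: in_subgraphs_iff[OF G] expand_def)
  qed
  then show ?thesis by (simp add: sum_distrib_left)
qed

text \<open>
  A subgraph of the contraction that misses \<open>w\<close> has no edge meeting the ends of \<open>e\<close> in \<open>G\<close>, so it lies
  in the part of \<open>G\<close> on which merging changes nothing, which is the extraction.
\<close>

lemma subgraph_sum_extract:
  fixes G :: "('v, 'e) mgraph"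
  assumes G: "multigraph G" and e: "e \<in> edges G" and w: "w = (SOME w. w \<in> ends G e)"
  shows "(\<Sum>K\<in>{K \<in> subgraphs (contract_edge G e). w \<notin> verts K}. subgraph_weight v x y K) =
    subgraph_sum v x y (extract_edge G e)"
  unfolding subgraph_sum_def
proof (rule sum.reindex_bij_witness
    [where i = "\<lambda>H. \<lparr>verts = verts H, edges = edges H, ends = ends (contract_edge G e)\<rparr>"
      and j = "\<lambda>K. \<lparr>verts = verts K, edges = edges K, ends = ends G\<rparr>"])
  let ?C = "contract_edge G e" and ?X = "extract_edge G e"
  have C: "multigraph ?C" and X: "multigraph ?X"
    by (rule multigraph_contract[OF G] multigraph_extract[OF G])+
  have w_in: "w \<in> ends G e"
    unfolding w using multigraph_ends(2)[OF G e] by (simp add: some_in_eq)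
  note m = merge_ends_eq[OF w]
  have away: "merge_ends G e ` S = S" if "S \<inter> ends G e = {}" for S
    using that by (auto simp: m image_iff)
  {
    fix K assume "K \<in> {K \<in> subgraphs ?C. w \<notin> verts K}"
    then have K: "K \<in> subgraphs ?C" and wK: "w \<notin> verts K" by auto
    have sub: "verts K \<subseteq> merge_ends G e ` verts G" "edges K \<subseteq> edges G - {e}"
      "ends K = (\<lambda>d. merge_ends G e ` ends G d)"
      "\<And>d. d \<in> edges K \<Longrightarrow> merge_ends G e ` ends G d \<subseteq> verts K"
      using K unfolding in_subgraphs_iff[OF C] by (auto simp: contract_edge_def)
    let ?H = "\<lparr>verts = verts K, edges = edges K, ends = ends G\<rparr>"
    show "\<lparr>verts = verts ?H, edges = edges ?H, ends = ends ?C\<rparr> = K"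
      by (simp add: sub(3) contract_edge_def)
    have "verts K \<subseteq> verts G - ends G e"
      using sub(1) wK by (auto simp: m split: if_splits)
    moreover have edge: "ends G d \<inter> ends G e = {}" "ends G d \<subseteq> verts K" if "d \<in> edges K" for d
      using sub(4)[OF that] wK by (auto simp: m split: if_splits)
    ultimately show in_X: "?H \<in> subgraphs ?X"
      using sub(2) unfolding in_subgraphs_iff[OF X] by (simp add: extract_edge_def) blast
    show "subgraph_weight v x y ?H = subgraph_weight v x y K"
    proof (rule subgraph_weight_same_ends)
      show "multigraph ?H" "multigraph K" using in_X K by (auto dest: subgraph_multigraph)
      show "ends ?H d = ends K d" if "d \<in> edges ?H" for d
        using edge(1)[of d] that by (simp add: sub(3) away)
    qed simp_all
  next
    fix H assume H: "H \<in> subgraphs ?X"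
    have sub: "verts H \<subseteq> verts G - ends G e" "edges H \<subseteq> edges G" "ends H = ends G"
      "\<And>d. d \<in> edges H \<Longrightarrow> ends G d \<subseteq> verts H" "\<And>d. d \<in> edges H \<Longrightarrow> ends G d \<inter> ends G e = {}"
      using H unfolding in_subgraphs_iff[OF X] by (auto simp: extract_edge_def)
    let ?K = "\<lparr>verts = verts H, edges = edges H, ends = ends ?C\<rparr>"
    show "\<lparr>verts = verts ?K, edges = edges ?K, ends = ends G\<rparr> = H"
      by (simp add: sub(3)[symmetric])
    have "verts H \<subseteq> merge_ends G e ` verts G"
      using away[of "verts H"] sub(1) by blast
    moreover have "edges H \<subseteq> edges G - {e}"
      using sub(2,5) w_in by blast
    moreover have "merge_ends G e ` ends G d \<subseteq> verts H" if "d \<in> edges H" for d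
      using sub(4,5)[OF that] by (simp add: away)
    moreover have "w \<notin> verts H" using sub(1) w_in by blast
    ultimately show "?K \<in> {K \<in> subgraphs ?C. w \<notin> verts K}"
      unfolding mem_Collect_eq in_subgraphs_iff[OF C] by (simp add: contract_edge_def)
  }
qed

lemma sum_split_by:
  assumes "finite S"
  shows "sum f S = sum f {a \<in> S. P a} + sum f {a \<in> S. \<not> P a}"
  using sum.Int_Diff[OF assms, of f "Collect P"] by (simp add: Int_def set_diff_eq)

lemma subgraph_sum_recurrence:
  assumes G: "multigraph G" and e: "e \<in> edges G"
  shows "subgraph_sum v x y G = subgraph_sum v x y (delete_edge G e) +
    y * v ^ (card (ends G e) - 1) *
      (subgraph_sum v x y (contract_edge G e) - subgraph_sum v x y (extract_edge G e))"
proof -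
  define w where "w = (SOME w. w \<in> ends G e)"
  have "subgraph_sum v x y (contract_edge G e) =
      (\<Sum>K\<in>{K \<in> subgraphs (contract_edge G e). w \<in> verts K}. subgraph_weight v x y K) +
      subgraph_sum v x y (extract_edge G e)"
    using sum_split_by[OF finite_subgraphs[OF multigraph_contract[OF G]],
        of "subgraph_weight v x y" e "\<lambda>K. w \<in> verts K"]
    by (simp add: subgraph_sum_def[of _ _ _ "contract_edge G e"] subgraph_sum_extract[OF G e w_def])
  moreover have "subgraph_sum v x y G =
      (\<Sum>H\<in>{H \<in> subgraphs G. e \<in> edges H}. subgraph_weight v x y H) +
      subgraph_sum v x y (delete_edge G e)"
    using sum_split_by[OF finite_subgraphs[OF G], of "subgraph_weight v x y" "\<lambda>H. e \<in> edges H"]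
    by (simp add: subgraph_sum_def[of _ _ _ G] subgraph_sum_delete[OF G])
  ultimately show ?thesis
    by (simp add: subgraph_sum_contract[OF G e w_def])
qed

section \<open>Functions satisfying the edge elimination recurrence\<close>

definition eliminates_edges ::
  "'a::comm_ring_1 \<Rightarrow> 'a \<Rightarrow> 'a \<Rightarrow> (('v, 'e) mgraph \<Rightarrow> 'a) \<Rightarrow> bool" where
  "eliminates_edges x y z f \<longleftrightarrow>
     (\<forall>G e. multigraph G \<and> e \<in> edges G \<longrightarrow>
        f G = f (delete_edge G e) + y * f (contract_edge G e) + z * f (extract_edge G e)) \<and>
     (\<forall>G. multigraph G \<and> edges G = {} \<longrightarrow> f G = x ^ card (verts G))"

lemma edge_elimination_induct [consumes 1, case_names edgeless edge]:
  assumes "multigraph G"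
    and edgeless: "\<And>G. multigraph G \<Longrightarrow> edges G = {} \<Longrightarrow> P G"
    and edge: "\<And>G e. multigraph G \<Longrightarrow> e \<in> edges G \<Longrightarrow> P (delete_edge G e) \<Longrightarrow>
      P (contract_edge G e) \<Longrightarrow> P (extract_edge G e) \<Longrightarrow> P G"
  shows "P G"
  using assms(1)
proof (induction "card (edges G)" arbitrary: G rule: less_induct)
  case less
  show ?case
  proof (cases "edges G = {}")
    case True
    with less.prems show ?thesis by (rule edgeless)
  next
    case False
    then obtain e where e: "e \<in> edges G" by blast
    have fin: "finite (edges G)" using less.prems by (simp add: multigraph_def)
    have smaller: "card F < card (edges G)" if "F \<subseteq> edges G - {e}" for F
      using that e fin by (intro psubset_card_mono) auto
    have "edges (extract_edge G e) \<subseteq> edges G - {e}"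
      using multigraph_ends(2)[OF less.prems e] by (auto simp: extract_edge_def)
    then show ?thesis
      using less.prems e
      by (intro edge[OF less.prems e] less.hyps smaller multigraph_delete multigraph_contract multigraph_extract)
        (simp_all add: delete_edge_def contract_edge_def)
  qed
qed

lemma eliminates_edges_unique:
  assumes "eliminates_edges x y z f" "eliminates_edges x y z g" "multigraph G"
  shows "f G = g G"
  using assms(3)
proof (induction G rule: edge_elimination_induct)
  case (edgeless G)
  then show ?case using assms(1,2) by (simp add: eliminates_edges_def)
next
  case (edge G e)
  have "h G = h (delete_edge G e) + y * h (contract_edge G e) + z * h (extract_edge G e)"
    if "eliminates_edges x y z h" for h
    using that edge(1,2) unfolding eliminates_edges_def by blast
  from this[OF assms(1)] this[OF assms(2)] edge(3-5) show ?case by simp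
qed

text \<open>
  With \<open>c = |e|\<close>, contraction loses \<open>c - 1\<close> vertices and extraction \<open>c\<close>. Hence the factor \<open>v^(- |V|)\<close>
  absorbs \<open>v^(c - 1)\<close> completely in the contraction term and leaves \<open>1 / v\<close> in the extraction term, for
  loops and proper edges alike.
\<close>

lemma scaled_subgraph_sum_eliminates_edges:
  fixes v x y :: "'a::field"
  assumes v: "v \<noteq> 0"
  shows "eliminates_edges ((1 + v * x) / v) y (- (y / v))
    (\<lambda>G. (1 / v) ^ card (verts G) * subgraph_sum v x y G)"
  unfolding eliminates_edges_def
proof (intro conjI allI impI; elim conjE)
  fix G :: "('v, 'e) mgraph" and e assume G: "multigraph G" and e: "e \<in> edges G"
  let ?S = "subgraph_sum v x y :: ('v, 'e) mgraph \<Rightarrow> 'a"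
  define b where "b = card (ends G e) - 1"
  define k where "k = card (verts (extract_edge G e))"
  have "card (ends G e) > 0"
    using G e by (auto simp: multigraph_def)
  then have cards: "card (verts G) = k + Suc b" "card (verts (contract_edge G e)) = Suc k"
    using card_contract_verts[OF G e] card_extract_verts[OF G e] by (simp_all add: b_def k_def)
  have card_delete: "card (verts (delete_edge G e)) = card (verts G)" by (simp add: delete_edge_def)
  have recurrence: "?S G = ?S (delete_edge G e) + y * v ^ b * (?S (contract_edge G e) - ?S (extract_edge G e))"
    unfolding b_def by (rule subgraph_sum_recurrence[OF G e])
  show "(1 / v) ^ card (verts G) * ?S G =
      (1 / v) ^ card (verts (delete_edge G e)) * ?S (delete_edge G e) +
      y * ((1 / v) ^ card (verts (contract_edge G e)) * ?S (contract_edge G e)) +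
      - (y / v) * ((1 / v) ^ card (verts (extract_edge G e)) * ?S (extract_edge G e))"
    unfolding recurrence card_delete cards k_def[symmetric]
    using v by (simp add: power_add field_simps)
next
  fix G :: "('v, 'e) mgraph" assume "multigraph G" "edges G = {}"
  then show "(1 / v) ^ card (verts G) * subgraph_sum v x y G = ((1 + v * x) / v) ^ card (verts G)"
    by (simp add: subgraph_sum_edgeless power_divide)
qed

section \<open>Existence of the edge elimination polynomial\<close>

text \<open>
  Neither the recurrence nor the edgeless values involve division, so a solution in the field of fractions
  whose parameters are polynomials takes polynomial values.
\<close>

lemma eliminates_edges_integral:
  assumes f: "eliminates_edges (to_fract a) (to_fract b) (to_fract c) f" and G: "multigraph G"
  shows "\<exists>p. f G = to_fract p"
  using G
proof (induction G rule: edge_elimination_induct)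
  case (edgeless G)
  then have "f G = to_fract a ^ card (verts G)"
    using f by (simp add: eliminates_edges_def)
  moreover have "to_fract a ^ n = to_fract (a ^ n)" for n by (induction n) simp_all
  ultimately show ?case by auto
next
  case (edge G e)
  from edge(3-5) obtain p q r where "f (delete_edge G e) = to_fract p"
    "f (contract_edge G e) = to_fract q" "f (extract_edge G e) = to_fract r" by auto
  then have "f G = to_fract (p + b * q + c * r)"
    using f edge(1,2) by (auto simp: eliminates_edges_def)
  then show ?case ..
qed

text \<open>
  A function defined by recursion over edges would have to be shown independent of the chosen order.
  Instead, \<open>\<xi>\<close> is read off from the normalised subgraph sum over the field of fractions, a closed formula
  for which the laws are already known. They transfer to polynomials because \<open>to_fract\<close> is injective.
\<close>

lemma edge_elimination_exists: "\<exists>\<xi> :: ('v, 'e) mgraph \<Rightarrow> poly3. is_edge_elimination \<xi>"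
proof -
  define X Y Z where "X = to_fract Var1" and "Y = to_fract Var2" and "Z = to_fract Var3"
  have YZ: "Y \<noteq> 0" "Z \<noteq> 0"
    by (simp_all add: Y_def Z_def Var2_def Var3_def)
  define v where "v = - (Y / Z)"
  \<comment> \<open>The parameters \<open>v\<close> and \<open>X + Z / Y\<close> invert the substitution, so that \<open>R\<close> below
    satisfies the recurrence with the parameters \<open>X\<close>, \<open>Y\<close>, \<open>Z\<close>.\<close>
  have v: "v \<noteq> 0" and vZ: "- (Y / v) = Z" and vX: "(1 + v * (X + Z / Y)) / v = X"
    using YZ by (simp_all add: v_def field_simps)
  define R where "R G = (1 / v) ^ card (verts G) * subgraph_sum v (X + Z / Y) Y G"
    for G :: "('v, 'e) mgraph"
  have R: "eliminates_edges X Y Z R"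
    using scaled_subgraph_sum_eliminates_edges[OF v, of "X + Z / Y" Y]
    unfolding vX vZ R_def .
  define \<xi> where "\<xi> G = (SOME p. R G = to_fract p)" for G :: "('v, 'e) mgraph"
  have \<xi>: "to_fract (\<xi> G) = R G" if "multigraph G" for G
  proof -
    have "\<exists>p. R G = to_fract p"
      using R that unfolding X_def Y_def Z_def by (rule eliminates_edges_integral)
    then show ?thesis unfolding \<xi>_def by (metis (mono_tags, lifting) someI_ex)
  qed
  have "\<xi> G = \<xi> G'" if "multigraph G" "multigraph G'" "isomorphic G G'" for G G'
  proof -
    have "card (verts G) = card (verts G')"
      using that(3) by (auto simp: isomorphic_def dest: bij_betw_same_card)
    then have "R G = R G'" by (simp add: R_def subgraph_sum_isomorphic[OF that])
    then show ?thesis using \<xi>[OF that(1)] \<xi>[OF that(2)] by (metis to_fract_eq_iff)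
  qed
  moreover have "\<xi> G = \<xi> (delete_edge G e) + Var2 * \<xi> (contract_edge G e) + Var3 * \<xi> (extract_edge G e)"
    if G: "multigraph G" and e: "e \<in> edges G" for G e
  proof -
    have "to_fract (\<xi> G) =
        to_fract (\<xi> (delete_edge G e) + Var2 * \<xi> (contract_edge G e) + Var3 * \<xi> (extract_edge G e))"
      using R G e unfolding eliminates_edges_def
      by (simp add: \<xi> multigraph_delete multigraph_contract multigraph_extract Y_def Z_def)
    then show ?thesis by (simp only: to_fract_eq_iff)
  qed
  moreover have "\<xi> (graph_union G G') = \<xi> G * \<xi> G'"
    if "multigraph G" "multigraph G'" "disjoint_graphs G G'" for G G'
  proof -
    have "card (verts (graph_union G G')) = card (verts G) + card (verts G')"
      using that by (auto simp: graph_union_def disjoint_graphs_def multigraph_def card_Un_disjoint)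
    then have "to_fract (\<xi> (graph_union G G')) = to_fract (\<xi> G * \<xi> G')"
      using that by (simp add: \<xi> multigraph_union R_def subgraph_sum_union power_add)
    then show ?thesis by (simp only: to_fract_eq_iff)
  qed
  moreover have "\<xi> G = Var1" if "verts G = {u}" "edges G = {}" for G u
  proof -
    have G: "multigraph G" using that by (simp add: multigraph_def)
    then have "R G = X" using R that by (simp add: eliminates_edges_def)
    then show ?thesis using \<xi>[OF G] by (simp add: X_def)
  qed
  ultimately have "is_edge_elimination \<xi>"
    unfolding is_edge_elimination_def graph_polynomial_def by blast
  then show ?thesis by blast
qed

lemma edge_elimination_poly: "is_edge_elimination edge_elimination_poly"
  unfolding edge_elimination_poly_def by (rule someI_ex[OF edge_elimination_exists])

text \<open>
  An edgeless graph is a disjoint union of single vertices. The value \<open>1\<close> on the empty graph is forced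
  by multiplicativity: uniting a single vertex with the empty graph gives \<open>Var1 = Var1 * \<xi>(empty)\<close>, and
  \<open>Var1\<close> can be cancelled.
\<close>

lemma edge_elimination_edgeless:
  fixes \<xi> :: "('v, 'e) mgraph \<Rightarrow> poly3"
  assumes \<xi>: "is_edge_elimination \<xi>" and G: "multigraph G" and no_edges: "edges G = {}"
  shows "\<xi> G = Var1 ^ card (verts G)"
proof -
  have union: "\<xi> (graph_union H K) = \<xi> H * \<xi> K"
    if "multigraph H" "multigraph K" "disjoint_graphs H K" for H K
    using \<xi> that unfolding is_edge_elimination_def by blast
  have single: "\<xi> H = Var1" if "verts H = {u}" "edges H = {}" for H u
    using \<xi> that unfolding is_edge_elimination_def by blast
  have iso: "\<xi> H = \<xi> K" if "multigraph H" "multigraph K" "isomorphic H K" for H K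
    using \<xi> that unfolding is_edge_elimination_def graph_polynomial_def by blast
  let ?D = "\<lambda>W. \<lparr>verts = W, edges = {}, ends = ends G\<rparr> :: ('v, 'e) mgraph"
  have union': "\<xi> (?D (insert u W)) = Var1 * \<xi> (?D W)" if "finite W" "u \<notin> W" for u W
  proof -
    have m: "multigraph (?D {u})" "multigraph (?D W)" "multigraph (?D (insert u W))"
      "disjoint_graphs (?D {u}) (?D W)"
      using that by (auto simp: multigraph_def disjoint_graphs_def)
    have "\<xi> (?D (insert u W)) = \<xi> (graph_union (?D {u}) (?D W))"
      by (rule iso[OF m(3) multigraph_union[OF m(1,2)]], rule isomorphic_same_ends)
        (simp_all add: graph_union_def)
    then show ?thesis using union[OF m(1,2,4)] single[of "?D {u}" u] by simp
  qed
  have "\<xi> (?D W) = Var1 ^ card W" if "finite W" for W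
    using that
  proof (induction W rule: finite_induct)
    case empty
    have "Var1 * \<xi> (?D {}) = Var1"
      using union'[of "{}" undefined] single[of "?D {undefined}" undefined] by simp
    moreover have "Var1 \<noteq> 0" by (simp add: Var1_def)
    ultimately show ?case by simp
  next
    case (insert u W)
    then show ?case using union'[of W u] by simp
  qed
  moreover have "finite (verts G)" using G by (simp add: multigraph_def)
  moreover have "?D (verts G) = G" using no_edges by simp
  ultimately show ?thesis by metis
qed

section \<open>Substitution into integer polynomials\<close>

text \<open>
  Both ways of moving from integer polynomials into a field, the substitution \<open>eval3\<close> and the embedding
  \<open>to_fract\<close>, are ring homomorphisms. The identities are proved for any homomorphism \<open>h\<close>: taking
  \<open>eval3\<close> gives the equations between values, and taking \<open>to_fract\<close> expresses the polynomials themselves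
  as required for calculability.
\<close>

definition ring_hom_map :: "('b::comm_ring_1 \<Rightarrow> 'a::comm_ring_1) \<Rightarrow> bool" where
  "ring_hom_map h \<longleftrightarrow> h 0 = 0 \<and> h 1 = 1 \<and>
     (\<forall>p q. h (p + q) = h p + h q) \<and> (\<forall>p q. h (p * q) = h p * h q)"

lemma ring_hom_map_power: "ring_hom_map h \<Longrightarrow> h (p ^ n) = h p ^ n"
  by (induction n) (simp_all add: ring_hom_map_def)

lemma ring_hom_map_sum: "ring_hom_map h \<Longrightarrow> h (sum f A) = (\<Sum>a\<in>A. h (f a))"
  by (induction A rule: infinite_finite_induct) (simp_all add: ring_hom_map_def)

lemma ring_hom_map_poly:
  assumes h: "ring_hom_map h"
  shows "ring_hom_map (\<lambda>p. poly (map_poly h p) c)"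
proof -
  have h_simps [simp]: "h 0 = 0" "h 1 = 1" "h (p + q) = h p + h q" "h (p * q) = h p * h q" for p q
    using h by (simp_all add: ring_hom_map_def)
  let ?E = "\<lambda>p. poly (map_poly h p) c"
  have add: "?E (p + q) = ?E p + ?E q" for p q
  proof (induction p q rule: poly_induct2)
    case (pCons a p b q)
    then show ?case by (simp add: map_poly_pCons algebra_simps)
  qed simp
  have "?E (p * q) = ?E p * ?E q" for p q
  proof (induction p)
    case (pCons a p)
    then show ?case by (simp add: map_poly_pCons map_poly_smult add algebra_simps)
  qed simp
  with add show ?thesis by (simp add: ring_hom_map_def)
qed

lemma ring_hom_map_eval3: "ring_hom_map (\<lambda>p. eval3 p a b c)"
  unfolding eval3_def
  by (intro ring_hom_map_poly) (simp add: ring_hom_map_def)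

lemma ring_hom_map_to_fract: "ring_hom_map to_fract"
  by (simp add: ring_hom_map_def)

lemma eval3_Var: "eval3 Var1 a b c = a" "eval3 Var2 a b c = b" "eval3 Var3 a b c = c"
  by (simp_all add: eval3_def Var1_def Var2_def Var3_def map_poly_pCons)

lemma ring_hom_subgraph_counting_poly:
  assumes "ring_hom_map h"
  shows "h (subgraph_counting_poly G) = subgraph_sum (h Var1) (h Var2) (h Var3) G"
proof -
  have "h (p * q) = h p * h q" for p q using assms by (simp add: ring_hom_map_def)
  then show ?thesis
    unfolding subgraph_counting_poly_def subgraph_sum_def subgraph_weight_def ring_hom_map_sum[OF assms]
    by (simp add: ring_hom_map_power[OF assms])
qed

lemma ring_hom_edge_elimination_poly:
  fixes h :: "poly3 \<Rightarrow> 'a::comm_ring_1"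
  assumes h: "ring_hom_map h"
  shows "eliminates_edges (h Var1) (h Var2) (h Var3)
    (\<lambda>G :: ('v, 'e) mgraph. h (edge_elimination_poly G))"
  unfolding eliminates_edges_def
proof (intro conjI allI impI; elim conjE)
  let ?\<xi> = "edge_elimination_poly :: ('v, 'e) mgraph \<Rightarrow> poly3"
  fix G :: "('v, 'e) mgraph" and e assume "multigraph G" "e \<in> edges G"
  then have "?\<xi> G = ?\<xi> (delete_edge G e) + Var2 * ?\<xi> (contract_edge G e) + Var3 * ?\<xi> (extract_edge G e)"
    using edge_elimination_poly[where 'a = 'v and 'b = 'e] unfolding is_edge_elimination_def by blast
  then show "h (?\<xi> G) = h (?\<xi> (delete_edge G e)) + h Var2 * h (?\<xi> (contract_edge G e)) +
      h Var3 * h (?\<xi> (extract_edge G e))"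
    using h by (simp add: ring_hom_map_def)
qed (simp add: edge_elimination_edgeless[OF edge_elimination_poly] ring_hom_map_power[OF h])

text \<open>
  Both \<open>h \<circ> \<xi>\<close> and the normalised subgraph sum satisfy the edge elimination recurrence with the same
  parameters, so they agree by uniqueness.
\<close>

lemma subgraph_sum_eq_edge_elimination:
  fixes h :: "poly3 \<Rightarrow> 'a::field"
  assumes h: "ring_hom_map h" and v: "v \<noteq> 0" and G: "multigraph G"
    and vars: "h Var1 = (1 + v * x) / v" "h Var2 = y" "h Var3 = - (y / v)"
  shows "subgraph_sum v x y G = v ^ card (verts G) * h (edge_elimination_poly G)"
proof -
  have "(1 / v) ^ card (verts G) * subgraph_sum v x y G = h (edge_elimination_poly G)"
    using scaled_subgraph_sum_eliminates_edges[OF v] ring_hom_edge_elimination_poly[OF h] G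
    unfolding vars by (rule eliminates_edges_unique)
  then show ?thesis using v by (simp add: field_simps)
qed

text \<open>
  This is the previous identity solved for \<open>\<xi>\<close>: with \<open>v = - y / z\<close> the parameters
  \<open>(1 + v (x + z / y)) / v\<close> and \<open>- y / v\<close> become \<open>x\<close> and \<open>z\<close>.
\<close>

lemma edge_elimination_eq_subgraph_sum:
  fixes h :: "poly3 \<Rightarrow> 'a::field"
  assumes h: "ring_hom_map h" and G: "multigraph G"
    and vars: "h Var1 = x" "h Var2 = y" "h Var3 = z" and yz: "y \<noteq> 0" "z \<noteq> 0"
  shows "h (edge_elimination_poly G) =
    (- (z / y)) ^ card (verts G) * subgraph_sum (- (y / z)) (x + z / y) y G"
proof -
  define v where "v = - (y / z)"
  have v: "v \<noteq> 0" and inverse: "- (z / y) * v = 1"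
    and "x = (1 + v * (x + z / y)) / v" "z = - (y / v)"
    using yz by (simp_all add: v_def field_simps)
  then have "subgraph_sum v (x + z / y) y G = v ^ card (verts G) * h (edge_elimination_poly G)"
    using subgraph_sum_eq_edge_elimination[OF h v G, of "x + z / y" y] vars by metis
  then have "(- (z / y)) ^ card (verts G) * subgraph_sum v (x + z / y) y G =
      (- (z / y) * v) ^ card (verts G) * h (edge_elimination_poly G)"
    by (simp only: power_mult_distrib mult.assoc)
  then show ?thesis unfolding inverse power_one mult_1_left v_def[symmetric] by (rule sym)
qed

lemma subgraph_counting_poly_eq_subgraph_sum:
  "subgraph_counting_poly G = subgraph_sum Var1 Var2 Var3 G"
  by (simp add: subgraph_counting_poly_def subgraph_sum_def subgraph_weight_def)

lemma graph_polynomial_subgraph_counting: "graph_polynomial subgraph_counting_poly"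
  unfolding graph_polynomial_def subgraph_counting_poly_eq_subgraph_sum
  by (blast intro: subgraph_sum_isomorphic)

lemma eval3_subgraph_counting_poly:
  "eval3 (subgraph_counting_poly G) v x y = subgraph_sum v x y G"
  using ring_hom_subgraph_counting_poly[OF ring_hom_map_eval3] by (simp add: eval3_Var)

lemma subgraph_sum_eq_eval3_edge_elimination_poly:
  fixes v x y :: "'a::field"
  assumes "v \<noteq> 0" "multigraph G"
  shows "subgraph_sum v x y G =
      v ^ card (verts G) * eval3 (edge_elimination_poly G) ((1 + v * x) / v) y (- (y / v))"
  by (rule subgraph_sum_eq_edge_elimination[OF ring_hom_map_eval3 assms]) (simp_all add: eval3_Var)

theorem corollary4:
  fixes G :: "('v, 'e) mgraph"
  assumes "multigraph G"
  shows "equivalent_graph_polynomials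
           (subgraph_counting_poly :: ('v, 'e) mgraph \<Rightarrow> poly3)
           (edge_elimination_poly :: ('v, 'e) mgraph \<Rightarrow> poly3) \<and>
         (\<forall>v x y :: 'a::field. v \<noteq> 0 \<longrightarrow>
            eval3 (subgraph_counting_poly G) v x y =
              v ^ card (verts G) * eval3 (edge_elimination_poly G) ((1 + v * x) / v) y (- (y / v))) \<and>
         (\<forall>x y z :: 'a. y \<noteq> 0 \<and> z \<noteq> 0 \<longrightarrow>
            eval3 (edge_elimination_poly G) x y z =
              (- (z / y)) ^ card (verts G) *
                eval3 (subgraph_counting_poly G) (- (y / z)) (x + z / y) y)"
proof (intro conjI allI impI)
  have nonzero: "to_fract Var1 \<noteq> 0" "to_fract Var2 \<noteq> 0" "to_fract Var3 \<noteq> 0"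
    by (simp_all add: Var1_def Var2_def Var3_def)
  show "equivalent_graph_polynomials
      (subgraph_counting_poly :: ('v, 'e) mgraph \<Rightarrow> poly3) edge_elimination_poly"
    unfolding equivalent_graph_polynomials_def calculable_from_def
  proof (intro conjI exI allI impI)
    show "graph_polynomial (subgraph_counting_poly :: ('v, 'e) mgraph \<Rightarrow> poly3)"
      by (rule graph_polynomial_subgraph_counting)
    show "graph_polynomial (edge_elimination_poly :: ('v, 'e) mgraph \<Rightarrow> poly3)"
      using edge_elimination_poly[where 'a = 'v and 'b = 'e] by (simp add: is_edge_elimination_def)
  next
    fix H :: "('v, 'e) mgraph" assume H: "multigraph H"
    let ?v = "to_fract Var1" and ?x = "to_fract Var2" and ?y = "to_fract Var3"
    show "to_fract (subgraph_counting_poly H) =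
        ?v ^ card (verts H) * eval3 (edge_elimination_poly H) ((1 + ?v * ?x) / ?v) ?y (- (?y / ?v))"
      unfolding ring_hom_subgraph_counting_poly[OF ring_hom_map_to_fract]
      by (rule subgraph_sum_eq_eval3_edge_elimination_poly[OF nonzero(1) H])
  next
    fix H :: "('v, 'e) mgraph" assume H: "multigraph H"
    let ?x = "to_fract Var1" and ?y = "to_fract Var2" and ?z = "to_fract Var3"
    show "to_fract (edge_elimination_poly H) =
        (- (?z / ?y)) ^ card (verts H) * eval3 (subgraph_counting_poly H) (- (?y / ?z)) (?x + ?z / ?y) ?y"
      unfolding eval3_subgraph_counting_poly
      by (rule edge_elimination_eq_subgraph_sum[OF ring_hom_map_to_fract H refl refl refl nonzero(2,3)])
  qed
  show "eval3 (subgraph_counting_poly G) v x y =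
      v ^ card (verts G) * eval3 (edge_elimination_poly G) ((1 + v * x) / v) y (- (y / v))"
    if "v \<noteq> 0" for v x y :: 'a
    unfolding eval3_subgraph_counting_poly by (rule subgraph_sum_eq_eval3_edge_elimination_poly[OF that assms])
  show "eval3 (edge_elimination_poly G) x y z =
      (- (z / y)) ^ card (verts G) * eval3 (subgraph_counting_poly G) (- (y / z)) (x + z / y) y"
    if "y \<noteq> 0 \<and> z \<noteq> 0" for x y z :: 'a
    unfolding eval3_subgraph_counting_poly
    by (rule edge_elimination_eq_subgraph_sum[OF ring_hom_map_eval3 assms])
      (use that in \<open>simp_all add: eval3_Var\<close>)
qed

end
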